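(* Let $\mathbb{K}\in\{\mathbb{R},\mathbb{C}\}$, let $L$ be a compact Hausdorff space, let $\rho\subseteq L\times L$ be a closed equivalence relation on $L$, let $R$ be a set of representatives of $\rho$, and let $S\subseteq(L\times R)\cap\rho$ be any closed subspace. Then the sequence $$\mathcal{C}_L(\rho,\mathbb{K})\xrightarrow{\ \mathrm{res}_S^{\rho}|_{\mathcal{C}_L(\rho,\mathbb{K})}\ }\mathcal{C}(S,\mathbb{K})\xrightarrow{\ \mathrm{res}_{S\cap D_L}^{S}\ }\mathcal{C}(S\cap D_L,\mathbb{K})$$ is exact. In particular, $$\mathrm{codim}(\mathcal{C}_\rho(L,\mathbb{K}))=\dim\big(\mathrm{Ker}(\mathrm{res}_S^{\rho})\cap\mathcal{C}_L(\rho,\mathbb{K})\big)+\dim\big(\mathrm{Ker}(\mathrm{res}_{S\cap D_L}^{S})\big).$$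
   Context: For a compact Hausdorff space $X$, $\mathcal{C}(X,\mathbb{K})$ is the Banach space of continuous functions $X\to\mathbb{K}$ with the sup-norm. For a closed subset $Y\subseteq X$, $\mathrm{res}_Y^X:\mathcal{C}(X,\mathbb{K})\to\mathcal{C}(Y,\mathbb{K})$ is the restriction map $f\mapsto f|_Y$. $D_L=\{(x,x):x\in L\}$ is the diagonal. The map $\Delta:\mathcal{C}(L,\mathbb{K})\to\mathcal{C}(L\times L,\mathbb{K})$ is $\Delta(f)(x,y)=f(x)-f(y)$, and $\Delta_\rho:=\mathrm{res}_\rho^{L\times L}\circ\Delta:\mathcal{C}(L,\mathbb{K})\to\mathcal{C}(\rho,\mathbb{K})$. Define $\mathcal{C}_\rho(L,\mathbb{K}):=\mathrm{Ker}(\Delta_\rho)=\{f\in\mathcal{C}(L,\mathbb{K}): x\,\rho\, y\Rightarrow f(x)=f(y)\}$ and $\mathcal{C}_L(\rho,\mathbb{K}):=\mathrm{Im}(\Delta_\rho)\subseteq\mathcal{C}(\rho,\mathbb{K})$. A set of representatives of $\rho$ is a subset $R\subseteq L$ containing exactly one element of each equivalence class. Dimensions are algebraic dimensions over $\mathbb{K}$, and $\mathrm{codim}(\mathcal{C}_\rho(L,\mathbb{K}))$ is the algebraic dimension of $\mathcal{C}(L,\mathbb{K})/\mathcal{C}_\rho(L,\mathbb{K})$. *)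

theory Defs
  imports
    "HOL-Analysis.Analysis"
    "HOL-Algebra.Algebraic_Closure_Type"
    "Jordan_Normal_Form.Missing_VectorSpace"
begin

unbundle cardinal_syntax

text \<open>Vector spaces are the carrier-based ones of the locale \<^locale>\<open>vectorspace\<close>; the scalar field
  is a type, turned into a ring record by \<^const>\<open>ring_of_type_algebra\<close>.\<close>

abbreviation real_scalars :: "real ring"
  where "real_scalars \<equiv> ring_of_type_algebra"

abbreviation complex_scalars :: "complex ring"
  where "complex_scalars \<equiv> ring_of_type_algebra"


subsection \<open>Linear algebra\<close>

text \<open>The algebraic dimension is a cardinal, represented as usual by a cardinal order, and to be
  compared with \<open>=o\<close>. The library's \<open>vectorspace.dim\<close> is a natural number and is meaningful for
  finite-dimensional spaces only.\<close>

definition vs_dim :: "('k, 'n) ring_scheme \<Rightarrow> ('k, 'v, 'm) module_scheme \<Rightarrow> 'v rel"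
  where "vs_dim K V = |SOME B. vectorspace.basis K V B|"

text \<open>The ring multiplication and unit of a \<^typ>\<open>('k, 'v) module\<close> record play no role; they are
  filled in as in \<^const>\<open>ring.func_space\<close>.\<close>

definition quotient_space :: "('k, 'v, 'm) module_scheme \<Rightarrow> 'v set \<Rightarrow> ('k, 'v set) module"
  where "quotient_space V W =
    \<lparr> carrier = a_rcosets\<^bsub>V\<^esub> W,
      mult = (\<lambda>A B. W),
      one = W,
      zero = W,
      add = (\<lambda>A B. A <+>\<^bsub>V\<^esub> B),
      smult = (\<lambda>c A. \<Union>v\<in>A. W +>\<^bsub>V\<^esub> (c \<odot>\<^bsub>V\<^esub> v)) \<rparr>"

definition vs_codim :: "('k, 'n) ring_scheme \<Rightarrow> ('k, 'v, 'm) module_scheme \<Rightarrow> 'v set \<Rightarrow> 'v set rel"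
  where "vs_codim K V W = vs_dim K (quotient_space V W)"

definition exact_at_middle ::
    "('k, 'n) ring_scheme \<Rightarrow> ('k, 'u, 'm1) module_scheme \<Rightarrow> ('k, 'v, 'm2) module_scheme \<Rightarrow>
     ('k, 'w, 'm3) module_scheme \<Rightarrow> ('u \<Rightarrow> 'v) \<Rightarrow> ('v \<Rightarrow> 'w) \<Rightarrow> bool"
  where "exact_at_middle K U V W f g \<longleftrightarrow>
    linear_map K U V f \<and> linear_map K V W g \<and> mod_hom.im U f = mod_hom.ker V W g"


subsection \<open>Spaces of continuous functions\<close>

text \<open>A function on \<open>T\<close> is represented by its extension to the whole type that is
  \<^const>\<open>undefined\<close> off \<^term>\<open>topspace T\<close>, so restriction of functions to a subset is
  \<^const>\<open>restrict\<close>. Only the vector space structure is recorded, not the sup-norm.\<close>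

definition cont_space :: "'x topology \<Rightarrow> ('k::{topological_space, field}, 'x \<Rightarrow> 'k) module"
  where "cont_space T =
    (ring.func_space (ring_of_type_algebra :: 'k ring) (topspace T))
      \<lparr> carrier := {f \<in> extensional (topspace T). continuous_map T euclidean f} \<rparr>"

abbreviation res :: "'x set \<Rightarrow> ('x \<Rightarrow> 'k) \<Rightarrow> ('x \<Rightarrow> 'k)"
  where "res Y f \<equiv> restrict f Y"

abbreviation pair_space :: "'a topology \<Rightarrow> ('a \<times> 'a) set \<Rightarrow> ('a \<times> 'a) topology"
  where "pair_space L Y \<equiv> subtopology (prod_topology L L) Y"

abbreviation diagonal :: "'a topology \<Rightarrow> ('a \<times> 'a) set"
  where "diagonal L \<equiv> Id_on (topspace L)"

definition Delta :: "'a topology \<Rightarrow> ('a \<Rightarrow> 'k::minus) \<Rightarrow> 'a \<times> 'a \<Rightarrow> 'k"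
  where "Delta L f = (\<lambda>(x, y) \<in> topspace (prod_topology L L). f x - f y)"

definition Delta_rel :: "'a topology \<Rightarrow> ('a \<times> 'a) set \<Rightarrow> ('a \<Rightarrow> 'k::minus) \<Rightarrow> 'a \<times> 'a \<Rightarrow> 'k"
  where "Delta_rel L \<rho> = res \<rho> \<circ> Delta L"

definition C_sub_rel :: "'a topology \<Rightarrow> ('a \<times> 'a) set \<Rightarrow> ('a \<Rightarrow> 'k::{topological_space, field}) set"
  where "C_sub_rel L \<rho> = mod_hom.ker (cont_space L) (cont_space (pair_space L \<rho>)) (Delta_rel L \<rho>)"

definition C_sub_L :: "'a topology \<Rightarrow> ('a \<times> 'a) set \<Rightarrow> ('a \<times> 'a \<Rightarrow> 'k::{topological_space, field}) set"
  where "C_sub_L L \<rho> = mod_hom.im (cont_space L) (Delta_rel L \<rho>)"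


subsection \<open>Representatives\<close>

definition representatives :: "'a set \<Rightarrow> ('a \<times> 'a) set \<Rightarrow> 'a set \<Rightarrow> bool"
  where "representatives A r R \<longleftrightarrow> R \<subseteq> A \<and> (\<forall>E \<in> A // r. \<exists>!x. x \<in> R \<inter> E)"

end

theory Submission
  imports Defs
begin

text \<open>
Exactness is an extension problem. A difference \<open>f x - f y\<close> vanishes on the diagonal, so the image of
the first map lies in the kernel of the second. Conversely, let \<open>g\<close> be continuous on \<open>S\<close> and zero on
the diagonal part of \<open>S\<close>. For \<open>(x, y) \<in> S\<close> the point \<open>y\<close> is the representative of the class of \<open>x\<close>, so
\<open>S\<close> is the graph of a function on its first projection. Prescribe \<open>f\<close> to be \<open>g (x, y)\<close> at the
first coordinates and \<open>0\<close> at the second coordinates of the pairs in \<open>S\<close>. A point \<open>x\<close> that is both is a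
representative, hence \<open>x = y\<close> and \<open>g (x, y) = 0\<close>: the prescription is consistent. It is continuous
because \<open>S\<close> is compact, so that projections of closed subsets of \<open>S\<close> are closed. Tietze's theorem
extends it to the whole space, and then \<open>f x - f y = g (x, y)\<close> on \<open>S\<close>. This is
\<open>difference_extension\<close>.

The codimension formula is linear algebra. By the first isomorphism theorem (\<open>vs_codim_ker\<close>) the
codimension of the kernel of \<open>Delta_rel\<close> is the dimension of its image, and by rank-nullity
(\<open>vs_dim_rank_nullity\<close>), applied to the restriction of \<open>res S\<close> to this image, that dimension is the sum
of the dimensions of a kernel and of an image; exactness identifies the image with the kernel of
the second map. The spaces are infinite-dimensional in general, so dimensions are cardinals: they are
well defined because every vector space has a basis (\<open>lin_indpt_extends_to_basis\<close>) and any two bases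
are equinumerous (\<open>bases_equinumerous\<close>).
\<close>


section \<open>Infinite bases and their cardinality\<close>

context vectorspace
begin

text \<open>Linear maps carry spans to spans, so this coefficient-free form of dependence is the convenient one
for moving independence along a linear map.\<close>

lemma lin_dep_iff_redundant:
  assumes U: "U \<subseteq> carrier V"
  shows "lin_dep U \<longleftrightarrow> (\<exists>u\<in>U. u \<in> span (U - {u}))"
proof
  assume "lin_dep U"
  then obtain A a v where A: "finite A" "A \<subseteq> U" "a \<in> A \<rightarrow> carrier K"
      "lincomb a A = \<zero>\<^bsub>V\<^esub>" "v \<in> A" "a v \<noteq> \<zero>\<^bsub>K\<^esub>"
    unfolding lin_dep_def by blast
  have "v \<in> span (A - {v})"
    by (rule lincomb_isolate(2)[OF A(1) _ A(3,5,6,4)]) (use A(2) U in blast)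
  moreover have "span (A - {v}) \<subseteq> span (U - {v})"
    using A(2) by (intro span_is_monotone) auto
  ultimately show "\<exists>u\<in>U. u \<in> span (U - {u})"
    using A(2,5) by blast
next
  assume "\<exists>u\<in>U. u \<in> span (U - {u})"
  then obtain u where u: "u \<in> U" "u \<in> span (U - {u})"
    by blast
  then have Uu: "U = (U - {u}) \<union> {u}"
    by blast
  show "lin_dep U"
  proof (cases "lin_dep (U - {u})")
    case True
    then show ?thesis
      by (rule supset_ld_is_ld) blast
  next
    case False
    then have "lin_dep ((U - {u}) \<union> {u})"
      by (subst lin_dep_iff_in_span[symmetric]) (use u U in blast)+
    with Uu show ?thesis
      by simp
  qed
qed

text \<open>Zorn's lemma applies because linear dependence has finite character.\<close>

lemma lin_indpt_extends_to_basis: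
  assumes A: "A \<subseteq> carrier V" "lin_indpt A"
  obtains B where "A \<subseteq> B" "basis B"
proof -
  define \<F> where "\<F> = {S. A \<subseteq> S \<and> S \<subseteq> carrier V \<and> lin_indpt S}"
  have "\<exists>M\<in>\<F>. \<forall>Y\<in>\<F>. M \<subseteq> Y \<longrightarrow> Y = M"
  proof (rule subset_Zorn_nonempty)
    show "\<F> \<noteq> {}"
      using A by (auto simp: \<F>_def)
    fix \<C>
    assume ne: "\<C> \<noteq> {}" and ch: "subset.chain \<F> \<C>"
    then have sub: "\<C> \<subseteq> \<F>"
      by (auto simp: subset_chain_def)
    have "lin_indpt (\<Union>\<C>)"
    proof
      assume "lin_dep (\<Union>\<C>)"
      then obtain F a v where F: "finite F" "F \<subseteq> \<Union>\<C>" "a \<in> F \<rightarrow> carrier K"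
          "lincomb a F = \<zero>\<^bsub>V\<^esub>" "v \<in> F" "a v \<noteq> \<zero>\<^bsub>K\<^esub>"
        unfolding lin_dep_def by blast
      \<comment> \<open>A dependency is finite, so it already lives in one member of the chain.\<close>
      obtain S where "S \<in> \<C>" "F \<subseteq> S"
        using finite_subset_Union_chain[OF F(1,2) ne ch] by blast
      moreover have "lin_dep S"
        using \<open>F \<subseteq> S\<close> by (rule lin_dep_crit[OF F(1) _ F(3,5,6,4)])
      ultimately show False
        using sub by (auto simp: \<F>_def)
    qed
    moreover have "A \<subseteq> \<Union>\<C>" "\<Union>\<C> \<subseteq> carrier V"
      using sub ne by (auto simp: \<F>_def)
    ultimately show "\<Union>\<C> \<in> \<F>"
      by (simp add: \<F>_def)
  qed
  then obtain B where "B \<in> \<F>" and max: "\<And>Y. Y \<in> \<F> \<Longrightarrow> B \<subseteq> Y \<Longrightarrow> Y = B"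
    by metis
  then have B: "A \<subseteq> B" "B \<subseteq> carrier V" "lin_indpt B"
    by (simp_all add: \<F>_def)
  have "maximal B (\<lambda>S. S \<subseteq> carrier V \<and> lin_indpt S)"
    unfolding maximal_def
  proof (intro conjI allI impI)
    fix S
    assume "B \<subseteq> S \<and> S \<subseteq> carrier V \<and> lin_indpt S"
    with B(1) show "S = B"
      by (intro max) (auto simp: \<F>_def)
  qed (use B in auto)
  then have "basis B"
    using max_li_is_gen B by (auto simp: basis_def)
  with B that show thesis
    by blast
qed

lemma generating_subset_of_basis_eq:
  assumes C: "basis C" and D: "D \<subseteq> C" and B: "gen_set B" "B \<subseteq> carrier V" "B \<subseteq> span D"
  shows "D = C"
proof (rule ccontr)
  assume "D \<noteq> C"
  then obtain c where c: "c \<in> C" "c \<notin> D"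
    using D by blast
  have CV: "C \<subseteq> carrier V" "lin_indpt C"
    using C by (auto simp: basis_def)
  then have "submodule K (span D) V"
    using D by (intro span_is_submodule) auto
  then have "carrier V \<subseteq> span D"
    using span_is_subset[OF B(3)] B(1) by simp
  also have "span D \<subseteq> span (C - {c})"
    using D c by (intro span_is_monotone) blast
  finally have "c \<in> span (C - {c})"
    using c CV by blast
  with lin_dep_iff_redundant[OF CV(1)] CV(2) c show False
    by blast
qed

text \<open>Write each vector of \<open>B\<close> as a combination of finitely many vectors of \<open>C\<close>. The vectors of \<open>C\<close>
that occur already generate the space, so all of \<open>C\<close> occurs. This is what compares the cardinalities
of two infinite bases: \<open>C\<close> is a union of \<open>|B|\<close> finite sets.\<close>

lemma basis_covered_by_supports:
  assumes B: "basis B" and C: "basis C"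
  obtains F where "\<And>b. b \<in> B \<Longrightarrow> finite (F b)" "C = (\<Union>b\<in>B. F b)"
proof -
  have BV: "B \<subseteq> carrier V" "gen_set B" and CV: "C \<subseteq> carrier V" "gen_set C"
    using B C by (simp_all add: basis_def)
  have ex: "\<forall>b\<in>B. \<exists>F. finite F \<and> F \<subseteq> C \<and> b \<in> span F"
  proof
    fix b
    assume "b \<in> B"
    then have "b \<in> span C"
      using BV(1) CV(2) by blast
    then obtain a F where F: "finite F" "F \<subseteq> C" "a \<in> F \<rightarrow> carrier K" "b = lincomb a F"
      unfolding span_def by blast
    then have "b \<in> span F"
      unfolding span_def by blast
    with F(1,2) show "\<exists>F. finite F \<and> F \<subseteq> C \<and> b \<in> span F"
      by blast
  qed
  obtain F where F: "\<forall>b\<in>B. finite (F b) \<and> F b \<subseteq> C \<and> b \<in> span (F b)"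
    using bchoice[OF ex] ..
  have "B \<subseteq> span (\<Union>b\<in>B. F b)"
  proof
    fix b
    assume "b \<in> B"
    then show "b \<in> span (\<Union>b\<in>B. F b)"
      using F span_is_monotone[of "F b" "\<Union>b\<in>B. F b"] by blast
  qed
  then have "(\<Union>b\<in>B. F b) = C"
    by (intro generating_subset_of_basis_eq[OF C _ BV(2,1)]) (use F in blast)
  then show thesis
    by (intro that[of F]) (use F in simp_all)
qed

lemma finite_basis_transfer:
  assumes "basis B" "basis C" "finite B"
  shows "finite C"
proof -
  obtain F where "\<And>b. b \<in> B \<Longrightarrow> finite (F b)" "C = (\<Union>b\<in>B. F b)"
    using basis_covered_by_supports[OF assms(1,2)] by blast
  with assms(3) show ?thesis
    by simp
qed

lemma infinite_basis_card_le:
  assumes B: "basis B" and C: "basis C" and inf: "infinite B"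
  shows "|C| \<le>o |B|"
proof -
  obtain F where F: "\<And>b. b \<in> B \<Longrightarrow> finite (F b)" "C = (\<Union>b\<in>B. F b)"
    using basis_covered_by_supports[OF B C] by blast
  have "\<forall>b\<in>B. |F b| \<le>o |B|"
    using F(1) inf by (simp add: ordLeq3_finite_infinite)
  then show ?thesis
    unfolding F(2) by (intro card_of_UNION_ordLeq_infinite inf card_of_mono1 order_refl)
qed

text \<open>For finite bases this is Steinitz replacement; for infinite ones, the covering by finite supports in
both directions together with Cantor--Bernstein. It makes \<^const>\<open>vs_dim\<close>, which is the cardinal of an
arbitrarily chosen basis, computable from any basis.\<close>

lemma bases_equinumerous:
  assumes B: "basis B" and C: "basis C"
  shows "|B| =o |C|"
proof (cases "finite B")
  case True
  then have fin: "finite C"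
    using finite_basis_transfer[OF B C] by simp
  have "card B = card C"
    using li_smaller_than_gen[OF True fin] li_smaller_than_gen[OF fin True] B C
    unfolding basis_def by (meson le_antisym)
  then obtain f where "bij_betw f B C"
    using finite_same_card_bij[OF True fin] by blast
  then show ?thesis
    using card_of_ordIso by blast
next
  case False
  then have "infinite C"
    using finite_basis_transfer[OF C B] by blast
  with False show ?thesis
    using infinite_basis_card_le[OF B C] infinite_basis_card_le[OF C B]
    by (simp add: ordIso_iff_ordLeq)
qed

lemma vs_dim_eq_card_basis:
  assumes "basis B"
  shows "vs_dim K V =o |B|"
proof -
  have "basis (SOME B. basis B)"
    using assms by (rule someI)
  then show ?thesis
    unfolding vs_dim_def using assms by (rule bases_equinumerous)
qed

end


section \<open>Rank and nullity as cardinals\<close>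

context vectorspace
begin

text \<open>Spans and independence may be computed in the ambient space, so bases of subspaces can be compared
inside one space.\<close>

lemma basis_of_submodule_iff:
  assumes "submodule K N V"
  shows "vectorspace.basis K (V\<lparr>carrier := N\<rparr>) A \<longleftrightarrow> lin_indpt A \<and> span A = N \<and> A \<subseteq> N"
proof -
  have "vectorspace K V" ..
  with assms have "subspace K N V"
    by (simp add: subspace_def)
  then interpret N: vectorspace K "V\<lparr>carrier := N\<rparr>"
    by (rule subspace_is_vs)
  show ?thesis
    using span_li_not_depend[OF _ assms, of A] by (auto simp: N.basis_def)
qed

lemma vs_dim_submodule:
  assumes "submodule K N V" "lin_indpt A" "span A = N" "A \<subseteq> N"
  shows "vs_dim K (V\<lparr>carrier := N\<rparr>) =o |A|"
proof -
  have "vectorspace K V" ..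
  with assms have "subspace K N V"
    by (simp add: subspace_def)
  then interpret N: vectorspace K "V\<lparr>carrier := N\<rparr>"
    by (rule subspace_is_vs)
  show ?thesis
    using assms by (intro N.vs_dim_eq_card_basis) (simp add: basis_of_submodule_iff)
qed

end

lemma card_of_disjoint_Un_csum:
  assumes "A \<inter> B = {}"
  shows "|A \<union> B| =o |A| +c |B|"
proof -
  have "(case_sum id id) ` (A <+> B) = A \<union> B"
    unfolding Plus_def image_Un image_image by simp
  moreover have "inj_on (case_sum id id) (A <+> B)"
    using assms by (auto simp: inj_on_def)
  ultimately have "bij_betw (case_sum id id) (A <+> B) (A \<union> B)"
    by (simp add: bij_betw_def)
  then have "|A <+> B| =o |A \<union> B|"
    using card_of_ordIso by blast
  then show ?thesis
    using Plus_csum ordIso_symmetric ordIso_transitive by blast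
qed

context linear_map
begin

lemma submodule_vimage:
  assumes "submodule K N W"
  shows "submodule K {v \<in> carrier V. T v \<in> N} V"
proof -
  interpret N: submodule K N W by fact
  show ?thesis
    by unfold_locales auto
qed

lemma image_span_subset:
  assumes "B \<subseteq> carrier V" "S \<subseteq> carrier W" "\<And>b. b \<in> B \<Longrightarrow> T b \<in> W.module.span S"
  shows "T ` V.module.span B \<subseteq> W.module.span S"
proof -
  have "V.module.span B \<subseteq> {v \<in> carrier V. T v \<in> W.module.span S}"
    using assms by (intro V.module.span_is_subset submodule_vimage W.module.span_is_submodule) auto
  then show ?thesis
    by blast
qed

lemma span_image_subset:
  assumes "B \<subseteq> carrier V" "w \<in> W.module.span (T ` B)"
  obtains v where "v \<in> V.module.span B" "w = T v"
proof -
  interpret B: submodule K "V.module.span B" V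
    using assms(1) by (rule V.module.span_is_submodule)
  have "submodule K (T ` V.module.span B) W"
  proof unfold_locales
    show "T ` V.module.span B \<subseteq> carrier W"
      using B.subset by auto
    show "\<zero>\<^bsub>W\<^esub> \<in> T ` V.module.span B"
      using B.zero_closed T0_is_0 by (metis image_eqI)
  next
    fix x y
    assume "x \<in> T ` V.module.span B" "y \<in> T ` V.module.span B"
    then obtain u v where "u \<in> V.module.span B" "v \<in> V.module.span B" "x = T u" "y = T v"
      by blast
    then have "x \<oplus>\<^bsub>W\<^esub> y = T (u \<oplus>\<^bsub>V\<^esub> v)" "u \<oplus>\<^bsub>V\<^esub> v \<in> V.module.span B"
      using B.subset by (simp_all add: subset_iff)
    then show "x \<oplus>\<^bsub>W\<^esub> y \<in> T ` V.module.span B"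
      by simp
  next
    fix c x
    assume "c \<in> carrier K" "x \<in> T ` V.module.span B"
    then obtain v where "v \<in> V.module.span B" "x = T v"
      by blast
    then have "c \<odot>\<^bsub>W\<^esub> x = T (c \<odot>\<^bsub>V\<^esub> v)" "c \<odot>\<^bsub>V\<^esub> v \<in> V.module.span B"
      using B.subset \<open>c \<in> carrier K\<close> by (simp_all add: subset_iff)
    then show "c \<odot>\<^bsub>W\<^esub> x \<in> T ` V.module.span B"
      by simp
  qed
  then have "W.module.span (T ` B) \<subseteq> T ` V.module.span B"
    using V.module.in_own_span[OF assms(1)] by (intro W.module.span_is_subset) blast+
  then show thesis
    using assms(2) that by blast
qed

text \<open>A basis \<open>A\<close> of the kernel extends to a basis \<open>B\<close> of the domain, and \<open>T\<close> maps \<open>B - A\<close> bijectively onto a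
basis of the image. Since \<open>B\<close> is the disjoint union of \<open>A\<close> and \<open>B - A\<close>, the cardinals add up, finite or
not.\<close>

theorem vs_dim_rank_nullity:
  "vs_dim K V =o vs_dim K (V\<lparr>carrier := ker\<rparr>) +c vs_dim K (W\<lparr>carrier := im\<rparr>)"
proof -
  have sub_ker: "submodule K ker V" and sub_im: "submodule K im W"
    by (rule ker_is_submodule im_is_submodule)+
  interpret Ker: vectorspace K "V\<lparr>carrier := ker\<rparr>"
    by (rule V.subspace_is_vs[OF kerT_is_subspace])
  obtain A where "Ker.basis A"
    using Ker.lin_indpt_extends_to_basis[of "{}"] by (auto simp: Ker.lin_dep_def)
  then have A: "V.module.lin_indpt A" "V.module.span A = ker" "A \<subseteq> ker"
    by (simp_all add: V.basis_of_submodule_iff[OF sub_ker])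
  have kerV: "ker \<subseteq> carrier V"
    by (auto simp: ker_def)
  then obtain B where B: "A \<subseteq> B" "V.basis B"
    using V.lin_indpt_extends_to_basis[OF _ A(1)] A(3) by blast
  define C where "C = B - A"
  have BV: "B \<subseteq> carrier V" "V.module.span B = carrier V" "V.module.lin_indpt B"
    using B(2) by (simp_all add: V.basis_def)
  have CV: "C \<subseteq> carrier V"
    using BV by (auto simp: C_def)
  \<comment> \<open>Injectivity on \<open>C\<close> and independence of \<open>T ` C\<close> both come from this: if \<open>T u = T c\<close>, then
    \<open>c - u\<close> lies in the kernel, the span of \<open>A\<close>, and \<open>c\<close> is redundant in \<open>B\<close>.\<close>
  have new: "T u \<noteq> T c" if c: "c \<in> C" and u: "u \<in> V.module.span C'" and C': "C' \<subseteq> C - {c}" for c u C'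
  proof
    assume eq: "T u = T c"
    have sub: "A \<union> C' \<subseteq> B - {c}"
      using C' c B(1) by (auto simp: C_def)
    then have "A \<union> C' \<subseteq> carrier V"
      using BV(1) by blast
    then interpret AC: submodule K "V.module.span (A \<union> C')" V
      by (rule V.module.span_is_submodule)
    have mono: "V.module.span A \<subseteq> V.module.span (A \<union> C')"
        "V.module.span C' \<subseteq> V.module.span (A \<union> C')"
      by (intro V.module.span_is_monotone; blast)+
    then have uV: "u \<in> carrier V" and cV: "c \<in> carrier V"
      using u c CV AC.subset by blast+
    have "c \<ominus>\<^bsub>V\<^esub> u \<in> ker"
      using uV cV eq by (simp add: ker_def W.module.M.minus_eq W.module.M.r_neg)
    then have "(c \<ominus>\<^bsub>V\<^esub> u) \<oplus>\<^bsub>V\<^esub> u \<in> V.module.span (A \<union> C')"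
      using A(2) mono u by (intro AC.m_closed) blast+
    moreover have "(c \<ominus>\<^bsub>V\<^esub> u) \<oplus>\<^bsub>V\<^esub> u = c"
      using uV cV by (simp add: V.module.M.minus_eq V.module.M.a_assoc V.module.M.l_neg)
    ultimately have "c \<in> V.module.span (B - {c})"
      using V.module.span_is_monotone[OF sub] by auto
    then show False
      using V.lin_dep_iff_redundant[OF BV(1)] BV(3) c by (auto simp: C_def)
  qed
  have inj: "inj_on T C"
  proof (rule inj_onI, rule ccontr)
    fix c d
    assume "c \<in> C" "d \<in> C" "T c = T d" "c \<noteq> d"
    then show False
      using new[of c d "{d}"] V.module.in_own_span[of "{d}"] CV by auto
  qed
  have TC: "T ` C \<subseteq> carrier W"
    using CV by auto
  have "W.module.lin_indpt (T ` C)"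
  proof
    assume "W.module.lin_dep (T ` C)"
    then obtain c where c: "c \<in> C" "T c \<in> W.module.span (T ` C - {T c})"
      using W.lin_dep_iff_redundant[OF TC] by blast
    moreover have "T ` C - {T c} = T ` (C - {c})"
      using inj c(1) by (auto simp: inj_on_def)
    ultimately have "T c \<in> W.module.span (T ` (C - {c}))"
      by simp
    then obtain u where "u \<in> V.module.span (C - {c})" "T c = T u"
      using span_image_subset[of "C - {c}"] CV by blast
    then show False
      using new[of c u "C - {c}"] c(1) by auto
  qed
  moreover have "W.module.span (T ` C) = im"
  proof
    show "W.module.span (T ` C) \<subseteq> im"
      using CV by (intro W.module.span_is_subset sub_im) (auto simp: im_def)
    have "T ` V.module.span B \<subseteq> W.module.span (T ` C)"
    proof (rule image_span_subset[OF BV(1) TC])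
      fix b
      assume b: "b \<in> B"
      show "T b \<in> W.module.span (T ` C)"
      proof (cases "b \<in> A")
        case True
        then have "T b = \<zero>\<^bsub>W\<^esub>"
          using A(3) by (auto simp: ker_def)
        then show ?thesis
          using W.module.span_is_submodule[OF TC] by (simp add: submodule.zero_closed)
      next
        case False
        with b have "T b \<in> T ` C"
          by (simp add: C_def)
        then show ?thesis
          using W.module.in_own_span[OF TC] by blast
      qed
    qed
    then show "im \<subseteq> W.module.span (T ` C)"
      by (simp add: BV(2) im_def)
  qed
  moreover have "T ` C \<subseteq> im"
    using CV by (auto simp: im_def)
  ultimately have "vs_dim K (W\<lparr>carrier := im\<rparr>) =o |T ` C|"
    by (intro W.vs_dim_submodule sub_im)
  also have "|T ` C| =o |C|"
    using inj by (meson card_of_ordIso bij_betw_imageI ordIso_symmetric)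
  finally have im: "vs_dim K (W\<lparr>carrier := im\<rparr>) =o |C|" .
  have ker: "vs_dim K (V\<lparr>carrier := ker\<rparr>) =o |A|"
    using A by (intro V.vs_dim_submodule sub_ker)
  have "B = A \<union> C" "A \<inter> C = {}"
    using B(1) by (auto simp: C_def)
  then have "|B| =o |A| +c |C|"
    using card_of_disjoint_Un_csum by metis
  with V.vs_dim_eq_card_basis[OF B(2)] have "vs_dim K V =o |A| +c |C|"
    by (rule ordIso_transitive)
  then show ?thesis
    using csum_cong[OF ker im] ordIso_symmetric ordIso_transitive by blast
qed

end


section \<open>Codimension of a kernel\<close>

text \<open>The vector space laws are equations and existence statements, so they pass to surjective images.\<close>

lemma vectorspace_surjective_image:
  assumes "vectorspace K V"
    and car: "carrier Q = q ` carrier V"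
    and add: "\<And>v w. v \<in> carrier V \<Longrightarrow> w \<in> carrier V \<Longrightarrow> q v \<oplus>\<^bsub>Q\<^esub> q w = q (v \<oplus>\<^bsub>V\<^esub> w)"
    and smult: "\<And>c v. c \<in> carrier K \<Longrightarrow> v \<in> carrier V \<Longrightarrow> c \<odot>\<^bsub>Q\<^esub> q v = q (c \<odot>\<^bsub>V\<^esub> v)"
    and zero: "\<zero>\<^bsub>Q\<^esub> = q \<zero>\<^bsub>V\<^esub>"
  shows "vectorspace K Q"
proof -
  interpret V: vectorspace K V by fact
  show ?thesis
  proof (rule vs_criteria)
    show "field K" ..
    show "\<zero>\<^bsub>Q\<^esub> \<in> carrier Q"
      by (simp add: car zero)
    show "\<forall>v\<in>carrier Q. \<exists>n\<in>carrier Q. v \<oplus>\<^bsub>Q\<^esub> n = \<zero>\<^bsub>Q\<^esub>"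
    proof
      fix v
      assume "v \<in> carrier Q"
      then obtain u where u: "u \<in> carrier V" "v = q u"
        by (auto simp: car)
      then have "v \<oplus>\<^bsub>Q\<^esub> q (\<ominus>\<^bsub>V\<^esub> u) = \<zero>\<^bsub>Q\<^esub>"
        by (simp add: add zero V.module.M.r_neg)
      then show "\<exists>n\<in>carrier Q. v \<oplus>\<^bsub>Q\<^esub> n = \<zero>\<^bsub>Q\<^esub>"
        using u by (auto simp: car)
    qed
  qed (auto simp: car add smult zero V.module.M.a_ac V.module.smult_assoc1
        V.module.smult_l_distr V.module.smult_r_distr)
qed

lemma (in vectorspace) vs_dim_zero_space:
  "vs_dim K (V\<lparr>carrier := {\<zero>\<^bsub>V\<^esub>}\<rparr>) =o |{} :: 'c set|"
proof (rule vs_dim_submodule)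
  show "submodule K {\<zero>\<^bsub>V\<^esub>} V"
    using span_is_submodule[of "{}"] by (simp add: span_empty)
qed (simp_all add: span_empty lin_dep_def)

lemma card_of_empty_csum: "|{} :: 'b set| +c |A| =o |A|"
  using Plus_csum[of "{} :: 'b set" A] card_of_Plus_empty2[of A]
  by (blast intro: ordIso_symmetric ordIso_transitive)

context linear_map
begin

text \<open>Describing cosets as fibres of \<open>T\<close> reduces the operations of \<^const>\<open>quotient_space\<close> to identities
between values of \<open>T\<close>.\<close>

lemma coset_ker_eq_fibre:
  assumes v: "v \<in> carrier V"
  shows "ker +>\<^bsub>V\<^esub> v = {w \<in> carrier V. T w = T v}"
proof -
  have "w \<in> ker +>\<^bsub>V\<^esub> v" if w: "w \<in> carrier V" "T w = T v" for w
  proof -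
    have "w \<ominus>\<^bsub>V\<^esub> v \<in> ker"
      using v w by (simp add: ker_def W.module.M.minus_eq W.module.M.r_neg)
    moreover have "w = (w \<ominus>\<^bsub>V\<^esub> v) \<oplus>\<^bsub>V\<^esub> v"
      using v w by (simp add: V.module.M.minus_eq V.module.M.a_assoc V.module.M.l_neg)
    ultimately show ?thesis
      unfolding a_r_coset_def' by blast
  qed
  then show ?thesis
    using v by (auto simp: a_r_coset_def' ker_def)
qed

lemma quotient_space_ker_simps:
  shows "carrier (quotient_space V ker) = (\<lambda>v. ker +>\<^bsub>V\<^esub> v) ` carrier V"
    and "\<lbrakk>v \<in> carrier V; w \<in> carrier V\<rbrakk> \<Longrightarrow>
      (ker +>\<^bsub>V\<^esub> v) \<oplus>\<^bsub>quotient_space V ker\<^esub> (ker +>\<^bsub>V\<^esub> w) = ker +>\<^bsub>V\<^esub> (v \<oplus>\<^bsub>V\<^esub> w)"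
    and "\<lbrakk>c \<in> carrier K; v \<in> carrier V\<rbrakk> \<Longrightarrow>
      c \<odot>\<^bsub>quotient_space V ker\<^esub> (ker +>\<^bsub>V\<^esub> v) = ker +>\<^bsub>V\<^esub> (c \<odot>\<^bsub>V\<^esub> v)"
    and "\<zero>\<^bsub>quotient_space V ker\<^esub> = ker +>\<^bsub>V\<^esub> \<zero>\<^bsub>V\<^esub>"
proof -
  show "carrier (quotient_space V ker) = (\<lambda>v. ker +>\<^bsub>V\<^esub> v) ` carrier V"
    by (auto simp: quotient_space_def A_RCOSETS_def' a_r_coset_def')
  show "\<zero>\<^bsub>quotient_space V ker\<^esub> = ker +>\<^bsub>V\<^esub> \<zero>\<^bsub>V\<^esub>"
    by (simp add: quotient_space_def coset_ker_eq_fibre) (simp add: ker_def)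
  show "(ker +>\<^bsub>V\<^esub> v) \<oplus>\<^bsub>quotient_space V ker\<^esub> (ker +>\<^bsub>V\<^esub> w) = ker +>\<^bsub>V\<^esub> (v \<oplus>\<^bsub>V\<^esub> w)"
    if vw: "v \<in> carrier V" "w \<in> carrier V"
  proof -
    have "u \<in> (ker +>\<^bsub>V\<^esub> v) <+>\<^bsub>V\<^esub> (ker +>\<^bsub>V\<^esub> w)" if u: "u \<in> carrier V" "T u = T v \<oplus>\<^bsub>W\<^esub> T w" for u
    proof -
      have "u = (u \<ominus>\<^bsub>V\<^esub> w) \<oplus>\<^bsub>V\<^esub> w"
        using vw u by (simp add: V.module.M.minus_eq V.module.M.a_assoc V.module.M.l_neg)
      moreover have "u \<ominus>\<^bsub>V\<^esub> w \<in> ker +>\<^bsub>V\<^esub> v" "w \<in> ker +>\<^bsub>V\<^esub> w"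
        using vw u by (simp_all add: coset_ker_eq_fibre W.module.M.minus_eq W.module.M.a_assoc
            W.module.M.r_neg)
      ultimately show ?thesis
        unfolding set_add_def' by blast
    qed
    moreover have "(ker +>\<^bsub>V\<^esub> v) <+>\<^bsub>V\<^esub> (ker +>\<^bsub>V\<^esub> w) \<subseteq> ker +>\<^bsub>V\<^esub> (v \<oplus>\<^bsub>V\<^esub> w)"
      using vw by (auto simp: coset_ker_eq_fibre set_add_def')
    ultimately show ?thesis
      using vw by (auto simp: quotient_space_def coset_ker_eq_fibre)
  qed
  show "c \<odot>\<^bsub>quotient_space V ker\<^esub> (ker +>\<^bsub>V\<^esub> v) = ker +>\<^bsub>V\<^esub> (c \<odot>\<^bsub>V\<^esub> v)"
    if cv: "c \<in> carrier K" "v \<in> carrier V"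
  proof -
    have "c \<odot>\<^bsub>quotient_space V ker\<^esub> (ker +>\<^bsub>V\<^esub> v)
        = (\<Union>w\<in>{w \<in> carrier V. T w = T v}. ker +>\<^bsub>V\<^esub> (c \<odot>\<^bsub>V\<^esub> w))"
      using cv by (simp add: quotient_space_def coset_ker_eq_fibre)
    also have "\<dots> = (\<Union>w\<in>{w \<in> carrier V. T w = T v}. ker +>\<^bsub>V\<^esub> (c \<odot>\<^bsub>V\<^esub> v))"
      using cv by (intro SUP_cong refl) (simp add: coset_ker_eq_fibre)
    also have "\<dots> = ker +>\<^bsub>V\<^esub> (c \<odot>\<^bsub>V\<^esub> v)"
      using cv by auto
    finally show ?thesis .
  qed
qed

lemma vectorspace_quotient_ker: "vectorspace K (quotient_space V ker)"
proof (rule vectorspace_surjective_image[where V = V])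
  show "vectorspace K V" ..
qed (rule quotient_space_ker_simps; assumption)+

text \<open>The first isomorphism theorem, at the level of dimensions: \<open>T\<close> induces an injective linear map on
the quotient with the same image, and rank-nullity applies to that map.\<close>

theorem vs_codim_ker: "vs_codim K V ker =o vs_dim K (W\<lparr>carrier := im\<rparr>)"
proof -
  let ?Q = "quotient_space V ker"
  \<comment> \<open>Since \<open>T\<close> is constant on cosets, any choice of representative will do.\<close>
  define \<phi> where "\<phi> E = T (SOME v. v \<in> E)" for E
  have \<phi>: "\<phi> (ker +>\<^bsub>V\<^esub> v) = T v" if "v \<in> carrier V" for v
  proof -
    have "v \<in> ker +>\<^bsub>V\<^esub> v"
      using that by (simp add: coset_ker_eq_fibre)
    then have "(SOME w. w \<in> ker +>\<^bsub>V\<^esub> v) \<in> ker +>\<^bsub>V\<^esub> v"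
      by (rule someI)
    then show ?thesis
      using that by (simp add: \<phi>_def coset_ker_eq_fibre)
  qed
  interpret Q: vectorspace K ?Q
    by (rule vectorspace_quotient_ker)
  interpret \<phi>: linear_map K ?Q W \<phi>
    by unfold_locales
      (auto simp: module_hom_def quotient_space_ker_simps \<phi>)
  have zero_ker: "\<phi>.ker = {\<zero>\<^bsub>?Q\<^esub>}"
  proof -
    have "T v = \<zero>\<^bsub>W\<^esub> \<longleftrightarrow> ker +>\<^bsub>V\<^esub> v = ker +>\<^bsub>V\<^esub> \<zero>\<^bsub>V\<^esub>" if "v \<in> carrier V" for v
      using that by (auto simp: coset_ker_eq_fibre)
    then show ?thesis
      unfolding \<phi>.ker_def quotient_space_ker_simps(1,4) using \<phi> by auto
  qed
  have im_eq: "\<phi>.im = im"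
    unfolding \<phi>.im_def im_def quotient_space_ker_simps(1) image_image using \<phi> by simp
  have "vs_dim K ?Q =o |{} :: 'c set set| +c vs_dim K (W\<lparr>carrier := im\<rparr>)"
    using \<phi>.vs_dim_rank_nullity Q.vs_dim_zero_space
    unfolding zero_ker im_eq by (blast intro: csum_cong1 ordIso_transitive)
  also have "|{} :: 'c set set| +c vs_dim K (W\<lparr>carrier := im\<rparr>) =o vs_dim K (W\<lparr>carrier := im\<rparr>)"
    unfolding vs_dim_def by (rule card_of_empty_csum)
  finally show ?thesis
    by (simp add: vs_codim_def)
qed

end


section \<open>Extending continuous functions\<close>

text \<open>Tietze's theorem for each coordinate; it treats the real and the complex scalars at once.\<close>

lemma Tietze_extension_euclidean:
  fixes f :: "'a \<Rightarrow> 'b::euclidean_space"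
  assumes X': "normal_space X'" and A: "closedin X' A"
    and f: "continuous_map (subtopology X' A) euclidean f"
  obtains g where "continuous_map X' euclidean g" "\<And>x. x \<in> A \<Longrightarrow> g x = f x"
proof -
  have "\<exists>g. continuous_map X' euclideanreal g \<and> (\<forall>x\<in>A. g x = f x \<bullet> b)" for b
  proof -
    have "continuous_map (subtopology X' A) euclideanreal ((\<lambda>y. y \<bullet> b) \<circ> f)"
      by (rule continuous_map_compose[OF f]) (auto intro!: continuous_intros)
    then show ?thesis
      using X' A unfolding normal_space_iff_Tietze by (metis comp_apply)
  qed
  then obtain g where g: "\<And>b. continuous_map X' euclideanreal (g b)"
      "\<And>b x. x \<in> A \<Longrightarrow> g b x = f x \<bullet> b"
    by metis
  show thesis
  proof
    have "continuous_map X' euclidean ((\<lambda>t. t *\<^sub>R b) \<circ> g b)" for b :: 'b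
      by (rule continuous_map_compose[OF g(1)]) (auto intro!: continuous_intros)
    then show "continuous_map X' euclidean (\<lambda>x. \<Sum>b\<in>Basis. g b x *\<^sub>R b)"
      by (intro continuous_map_sum) (simp_all add: o_def)
    show "(\<Sum>b\<in>Basis. g b x *\<^sub>R b) = f x" if "x \<in> A" for x
      using that by (simp add: g(2) euclidean_representation)
  qed
qed

text \<open>By \<open>fst_inj\<close>, the set \<open>S\<close> is the graph of a function on its first projection. So one can prescribe
\<open>f = 0\<close> on the second projection and \<open>f x = g (x, y)\<close> on the first. The two prescriptions agree where
the projections meet, since there \<open>overlap\<close> puts the pair on the diagonal and \<open>g\<close> vanishes. Both
projections are compact, which makes the prescribed function continuous on a closed set, and Tietze's
theorem extends it.\<close>

lemma difference_extension:
  fixes g :: "'x \<times> 'x \<Rightarrow> 'k::euclidean_space"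
  assumes L: "compact_space L" "Hausdorff_space L"
    and S: "closedin (prod_topology L L) S"
    and fst_inj: "\<And>x y z. (x, y) \<in> S \<Longrightarrow> (x, z) \<in> S \<Longrightarrow> y = z"
    and overlap: "\<And>x y z. (x, y) \<in> S \<Longrightarrow> (z, x) \<in> S \<Longrightarrow> x = y"
    and g: "continuous_map (pair_space L S) euclidean g"
    and diag: "\<And>x. (x, x) \<in> S \<Longrightarrow> g (x, x) = 0"
  obtains f where "continuous_map L euclidean f" "\<And>x y. (x, y) \<in> S \<Longrightarrow> f x - f y = g (x, y)"
proof -
  have SL: "S \<subseteq> topspace L \<times> topspace L"
    using closedin_subset[OF S] by simp
  have topS: "topspace (pair_space L S) = S"
    using SL by auto
  \<comment> \<open>The projections of closed sets of pairs are compact, hence closed.\<close>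
  have proj: "closedin L (fst ` P)" "closedin L (snd ` P)" if P: "closedin (pair_space L S) P" for P
  proof -
    have "closedin (prod_topology L L) P"
      using closedin_trans_full[OF P S] .
    then have "compactin (prod_topology L L) P"
      using L(1) by (intro closedin_compact_space) (auto simp: compact_space_prod_topology)
    then show "closedin L (fst ` P)" "closedin L (snd ` P)"
      by (auto intro: compactin_imp_closedin[OF L(2)] image_compactin continuous_map_fst continuous_map_snd)
  qed
  define A where "A = fst ` S \<union> snd ` S"
  have S': "closedin (pair_space L S) S"
    using topS by (metis closedin_topspace)
  have A: "closedin L A"
    unfolding A_def by (intro closedin_Un proj S')
  define h where "h x = (if x \<in> fst ` S then g (x, THE y. (x, y) \<in> S) else 0)" for x
  have h_fst: "h x = g (x, y)" if "(x, y) \<in> S" for x y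
  proof -
    have "(THE y. (x, y) \<in> S) = y"
      using that fst_inj by blast
    then show ?thesis
      using that by (force simp: h_def)
  qed
  have h_snd: "h y = 0" if "(x, y) \<in> S" for x y
  proof (cases "y \<in> fst ` S")
    case True
    then obtain z where "(y, z) \<in> S"
      by auto
    moreover from this have "y = z"
      using overlap that by blast
    ultimately show ?thesis
      using h_fst diag by auto
  qed (simp add: h_def)
  \<comment> \<open>The preimage of a closed set under \<open>h\<close> is a union of projections of closed parts of \<open>S\<close>.\<close>
  have "continuous_map (subtopology L A) euclidean h"
    unfolding continuous_map_closedin
  proof (intro conjI ballI allI impI)
    fix D :: "'k set"
    assume D: "closedin euclidean D"
    let ?P = "{p \<in> topspace (pair_space L S). g p \<in> D}"
    have P: "closedin (pair_space L S) ?P"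
      using g D by (rule closedin_continuous_map_preimage)
    have "{x \<in> topspace (subtopology L A). h x \<in> D} = fst ` ?P \<union> (if 0 \<in> D then snd ` S else {})" (is "?l = ?r")
    proof
      show "?l \<subseteq> ?r"
      proof
        fix x
        assume "x \<in> ?l"
        then have x: "x \<in> fst ` S \<or> x \<in> snd ` S" "h x \<in> D"
          by (auto simp: A_def)
        show "x \<in> ?r"
        proof (cases "x \<in> fst ` S")
          case True
          then obtain y where "(x, y) \<in> S"
            by auto
          then have "(x, y) \<in> ?P"
            using x(2) h_fst topS by auto
          then show ?thesis
            by force
        next
          case False
          then show ?thesis
            using x by (simp add: h_def)
        qed
      qed
      show "?r \<subseteq> ?l"
      proof
        fix x
        assume "x \<in> ?r"
        then consider y where "(x, y) \<in> S" "g (x, y) \<in> D" | y where "(y, x) \<in> S" "0 \<in> D"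
          by (auto split: if_splits)
        then have "x \<in> A \<and> h x \<in> D"
        proof cases
          case (1 y)
          then show ?thesis
            using h_fst by (force simp: A_def)
        next
          case (2 y)
          then show ?thesis
            using h_snd by (force simp: A_def)
        qed
        then show "x \<in> ?l"
          using closedin_subset[OF A] by auto
      qed
    qed
    moreover have "closedin L (fst ` ?P \<union> (if 0 \<in> D then snd ` S else {}))"
      using proj[OF P] proj[OF S'] by auto
    ultimately show "closedin (subtopology L A) {x \<in> topspace (subtopology L A). h x \<in> D}"
      by (metis (no_types, lifting) closedin_closed_subtopology A mem_Collect_eq subsetI topspace_subtopology IntD2)
  qed simp
  then obtain f where f: "continuous_map L euclidean f" "\<And>x. x \<in> A \<Longrightarrow> f x = h x"
    using Tietze_extension_euclidean[OF compact_Hausdorff_or_regular_imp_normal_space A] L by blast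
  show thesis
  proof
    show "f x - f y = g (x, y)" if "(x, y) \<in> S" for x y
    proof -
      have "x \<in> A" "y \<in> A"
        using that by (force simp: A_def)+
      then show ?thesis
        using that by (simp add: f(2) h_fst h_snd)
    qed
  qed (rule f(1))
qed


section \<open>Linear maps between spaces of continuous functions\<close>

lemma ring_of_type_algebra_simps [simp]:
  "carrier (ring_of_type_algebra :: 'k::field ring) = UNIV"
  "x \<otimes>\<^bsub>ring_of_type_algebra :: 'k::field ring\<^esub> y = x * y"
  "x \<oplus>\<^bsub>ring_of_type_algebra :: 'k::field ring\<^esub> y = x + y"
  "\<zero>\<^bsub>ring_of_type_algebra :: 'k::field ring\<^esub> = 0"
  by (simp_all add: ring_of_type_algebra_def)

lemma func_space_field:
  "module (ring_of_type_algebra :: 'k::field ring) (ring.func_space (ring_of_type_algebra :: 'k ring) A)"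
  by (rule cring.func_space_is_module) (rule cring_from_type_algebra)

lemmas func_space_field_def = ring.func_space_def[OF ring_from_type_algebra]

lemma cont_space_simps:
  fixes Y :: "'x topology"
  shows "f \<in> carrier (cont_space Y :: ('k, 'x \<Rightarrow> 'k::{topological_space, field}) module) \<longleftrightarrow>
      f \<in> extensional (topspace Y) \<and> continuous_map Y euclidean f"
    and "f \<oplus>\<^bsub>cont_space Y :: ('k, 'x \<Rightarrow> 'k) module\<^esub> g = (\<lambda>x\<in>topspace Y. f x + g x)"
    and "c \<odot>\<^bsub>cont_space Y :: ('k, 'x \<Rightarrow> 'k) module\<^esub> f = (\<lambda>x\<in>topspace Y. c * f x)"
    and "\<zero>\<^bsub>cont_space Y :: ('k, 'x \<Rightarrow> 'k) module\<^esub> = (\<lambda>x\<in>topspace Y. 0)"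
  by (simp_all add: cont_space_def func_space_field_def)

lemma continuous_map_cmult:
  fixes f :: "'x \<Rightarrow> 'k::real_normed_algebra"
  assumes "continuous_map Y euclidean f"
  shows "continuous_map Y euclidean (\<lambda>x. c * f x)"
proof -
  have "continuous_map Y euclidean ((\<lambda>y. c * y) \<circ> f)"
    by (rule continuous_map_compose[OF assms]) (auto intro!: continuous_intros)
  then show ?thesis
    by (simp add: o_def)
qed

lemma continuous_map_restrict_topspace:
  "continuous_map Y Z (restrict f (topspace Y)) \<longleftrightarrow> continuous_map Y Z f"
  by (metis continuous_map_eq restrict_apply')

lemma vectorspace_cont_space:
  "vectorspace (ring_of_type_algebra :: 'k::real_normed_field ring)
     (cont_space Y :: ('k, 'x \<Rightarrow> 'k) module)"
proof -
  let ?F = "ring.func_space (ring_of_type_algebra :: 'k ring) (topspace Y)"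
  interpret F: module "ring_of_type_algebra :: 'k ring" ?F
    by (rule func_space_field)
  have "submodule (ring_of_type_algebra :: 'k ring)
      {f \<in> extensional (topspace Y). continuous_map Y euclidean f} ?F"
    by unfold_locales
      (auto simp: func_space_field_def PiE_def continuous_map_restrict_topspace
        intro: continuous_map_add continuous_map_cmult)
  then have "module (ring_of_type_algebra :: 'k ring) (cont_space Y :: ('k, 'x \<Rightarrow> 'k) module)"
    unfolding cont_space_def by (rule F.submodule_is_module)
  then show ?thesis
    by (simp add: vectorspace_def field_from_type_algebra)
qed

text \<open>Functions are \<^const>\<open>undefined\<close> off their space, so linearity only has to be checked at its points.\<close>

lemma linear_map_cont_spaceI:
  fixes \<Phi> :: "('x \<Rightarrow> 'k::real_normed_field) \<Rightarrow> 'y \<Rightarrow> 'k"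
  assumes maps: "\<And>f. f \<in> carrier (cont_space Y) \<Longrightarrow> \<Phi> f \<in> carrier (cont_space Z)"
    and add: "\<And>f g z. z \<in> topspace Z \<Longrightarrow> \<Phi> (f \<oplus>\<^bsub>cont_space Y\<^esub> g) z = \<Phi> f z + \<Phi> g z"
    and smult: "\<And>c f z. z \<in> topspace Z \<Longrightarrow> \<Phi> (c \<odot>\<^bsub>cont_space Y\<^esub> f) z = c * \<Phi> f z"
  shows "linear_map ring_of_type_algebra (cont_space Y) (cont_space Z) \<Phi>"
proof -
  let ?K = "ring_of_type_algebra :: 'k ring"
  interpret Y: vectorspace ?K "cont_space Y"
    by (rule vectorspace_cont_space)
  interpret Z: vectorspace ?K "cont_space Z"
    by (rule vectorspace_cont_space)
  show ?thesis
  proof (intro linear_map.intro mod_hom.intro mod_hom_axioms.intro)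
    have "\<Phi> (f \<oplus>\<^bsub>cont_space Y\<^esub> g) = \<Phi> f \<oplus>\<^bsub>cont_space Z\<^esub> \<Phi> g"
      if "f \<in> carrier (cont_space Y)" "g \<in> carrier (cont_space Y)" for f g
    proof (rule extensionalityI)
      show "\<Phi> (f \<oplus>\<^bsub>cont_space Y\<^esub> g) \<in> extensional (topspace Z)"
        using maps[OF Y.module.M.a_closed[OF that]] by (simp add: cont_space_simps(1))
      show "\<Phi> (f \<oplus>\<^bsub>cont_space Y\<^esub> g) z = (\<Phi> f \<oplus>\<^bsub>cont_space Z\<^esub> \<Phi> g) z" if "z \<in> topspace Z" for z
        using add[OF that, of f g] that by (simp add: cont_space_simps(2)[of Z])
    qed (simp add: cont_space_simps(2)[of Z])
    moreover have "\<Phi> (c \<odot>\<^bsub>cont_space Y\<^esub> f) = c \<odot>\<^bsub>cont_space Z\<^esub> \<Phi> f"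
      if "f \<in> carrier (cont_space Y)" for c f
    proof (rule extensionalityI)
      show "\<Phi> (c \<odot>\<^bsub>cont_space Y\<^esub> f) \<in> extensional (topspace Z)"
        using maps[OF Y.module.smult_closed[OF _ that, of c]] by (simp add: cont_space_simps(1))
      show "\<Phi> (c \<odot>\<^bsub>cont_space Y\<^esub> f) z = (c \<odot>\<^bsub>cont_space Z\<^esub> \<Phi> f) z" if "z \<in> topspace Z" for z
        using smult[OF that, of c f] that by (simp add: cont_space_simps(3)[of Z])
    qed (simp add: cont_space_simps(3)[of Z])
    ultimately show "\<Phi> \<in> module_hom ?K (cont_space Y) (cont_space Z)"
      using maps by (auto simp: module_hom_def)
  qed unfold_locales
qed


lemma linear_map_res:
  assumes "B \<subseteq> A" "A \<subseteq> topspace Y"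
  shows "linear_map ring_of_type_algebra
    (cont_space (subtopology Y A) :: ('k, 'x \<Rightarrow> 'k::real_normed_field) module)
    (cont_space (subtopology Y B)) (res B)"
proof (rule linear_map_cont_spaceI)
  have top: "topspace (subtopology Y A) = A" "topspace (subtopology Y B) = B"
    using assms by auto
  show "res B f \<in> carrier (cont_space (subtopology Y B))"
    if "f \<in> carrier (cont_space (subtopology Y A))" for f :: "'x \<Rightarrow> 'k"
  proof -
    have "continuous_map (subtopology Y B) euclidean f"
      using that assms(1) by (auto simp: cont_space_simps intro: continuous_map_from_subtopology_mono)
    then show ?thesis
      using continuous_map_restrict_topspace[of "subtopology Y B" euclidean f]
      unfolding cont_space_simps(1) top by blast
  qed
next
  fix f g :: "'x \<Rightarrow> 'k" and c z
  assume "z \<in> topspace (subtopology Y B)"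
  then have "z \<in> B" "z \<in> topspace (subtopology Y A)"
    using assms by auto
  then show "res B (f \<oplus>\<^bsub>cont_space (subtopology Y A)\<^esub> g) z = res B f z + res B g z"
    and "res B (c \<odot>\<^bsub>cont_space (subtopology Y A)\<^esub> f) z = c * res B f z"
    by (simp_all add: cont_space_simps(2,3))
qed

lemma Delta_rel_apply:
  assumes "\<rho> \<subseteq> topspace L \<times> topspace L"
  shows "Delta_rel L \<rho> f = (\<lambda>p\<in>\<rho>. f (fst p) - f (snd p))"
  using assms by (auto simp: Delta_rel_def Delta_def fun_eq_iff)

lemma linear_map_Delta_rel:
  assumes \<rho>: "\<rho> \<subseteq> topspace L \<times> topspace L"
  shows "linear_map ring_of_type_algebra
    (cont_space L :: ('k, 'x \<Rightarrow> 'k::real_normed_field) module)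
    (cont_space (pair_space L \<rho>)) (Delta_rel L \<rho>)"
proof (rule linear_map_cont_spaceI)
  have top: "topspace (pair_space L \<rho>) = \<rho>"
    using \<rho> by auto
  show "Delta_rel L \<rho> f \<in> carrier (cont_space (pair_space L \<rho>))"
    if "f \<in> carrier (cont_space L)" for f :: "'x \<Rightarrow> 'k"
  proof -
    have f: "continuous_map L euclidean f"
      using that by (simp add: cont_space_simps)
    have "continuous_map (prod_topology L L) euclidean (\<lambda>p. f (fst p) - f (snd p))"
      using continuous_map_compose[OF continuous_map_fst f] continuous_map_compose[OF continuous_map_snd f]
      by (intro continuous_map_diff) (simp_all add: o_def)
    then have "continuous_map (pair_space L \<rho>) euclidean (\<lambda>p. f (fst p) - f (snd p))"
      by (rule continuous_map_from_subtopology)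
    then show ?thesis
      using continuous_map_restrict_topspace[of "pair_space L \<rho>" euclidean "\<lambda>p. f (fst p) - f (snd p)"]
      unfolding cont_space_simps(1) Delta_rel_apply[OF \<rho>] top by blast
  qed
next
  fix f g :: "'x \<Rightarrow> 'k" and c z
  assume "z \<in> topspace (pair_space L \<rho>)"
  then have "z \<in> \<rho>" "fst z \<in> topspace L" "snd z \<in> topspace L"
    using \<rho> by auto
  then show "Delta_rel L \<rho> (f \<oplus>\<^bsub>cont_space L\<^esub> g) z = Delta_rel L \<rho> f z + Delta_rel L \<rho> g z"
    and "Delta_rel L \<rho> (c \<odot>\<^bsub>cont_space L\<^esub> f) z = c * Delta_rel L \<rho> f z"
    by (simp_all add: cont_space_simps(2,3) Delta_rel_apply[OF \<rho>] right_diff_distrib)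
qed

lemma linear_map_restrict_domain:
  assumes "linear_map K V W T" "subspace K N V"
  shows "linear_map K (V\<lparr>carrier := N\<rparr>) W T"
proof -
  interpret T: linear_map K V W T by fact
  interpret N: vectorspace K "V\<lparr>carrier := N\<rparr>"
    using assms(2) by (rule T.V.subspace_is_vs)
  have "N \<subseteq> carrier V"
    using assms(2) by (blast dest: subspace.submod LinearCombinations.submodule.subset)
  then have "T \<in> module_hom K (V\<lparr>carrier := N\<rparr>) W"
    using T.f_hom by (simp add: module_hom_def Pi_iff subset_iff)
  then show ?thesis
    by (intro linear_map.intro mod_hom.intro mod_hom_axioms.intro
        vectorspace.axioms(1)[OF N.vectorspace_axioms] vectorspace.axioms(1)[OF T.W.vectorspace_axioms]
        N.vectorspace_axioms T.W.vectorspace_axioms)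
qed


section \<open>The exact sequence and the codimension formula\<close>

lemma representatives_unique:
  assumes "equiv A r" "representatives A r R" "y \<in> R" "z \<in> R" "(y, z) \<in> r"
  shows "y = z"
proof -
  have y: "y \<in> A"
    using assms(2,3) by (auto simp: representatives_def)
  have "\<forall>E\<in>A // r. \<exists>!x. x \<in> R \<inter> E"
    using assms(2) unfolding representatives_def by (rule conjunct2)
  then have "\<exists>!x. x \<in> R \<inter> r `` {y}"
    using quotientI[OF y] by (rule bspec)
  moreover have "y \<in> R \<inter> r `` {y}" "z \<in> R \<inter> r `` {y}"
    using assms(3-5) equiv_class_self[OF assms(1) y] by auto
  ultimately show ?thesis
    by blast
qed

text \<open>The scalars are kept general so that one proof serves \<open>real\<close> and \<open>complex\<close>. Since equivalent
representatives are equal, \<open>S\<close> satisfies both conditions that the extension of differences needs: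
two second coordinates of the same point are equivalent representatives, and so are the coordinates
of a pair whose first coordinate is itself a second coordinate, that is, a representative.\<close>

lemma exact_and_codim_cont_space:
  fixes L :: "'a topology" and \<rho> S :: "('a \<times> 'a) set" and R :: "'a set"
  defines "K \<equiv> (ring_of_type_algebra :: 'k::{real_normed_field, euclidean_space} ring)"
  assumes L: "compact_space L" "Hausdorff_space L"
    and \<rho>: "equiv (topspace L) \<rho>" "closedin (prod_topology L L) \<rho>"
    and R: "representatives (topspace L) \<rho> R"
    and S: "S \<subseteq> (topspace L \<times> R) \<inter> \<rho>" "closedin (prod_topology L L) S"
  shows "exact_at_middle K
       ((cont_space (pair_space L \<rho>))\<lparr>carrier := C_sub_L L \<rho>\<rparr>)
       (cont_space (pair_space L S))
       (cont_space (pair_space L (S \<inter> diagonal L)))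
       (res S) (res (S \<inter> diagonal L))" (is ?exact)
    and "vs_codim K (cont_space L) (C_sub_rel L \<rho>) =o
       vs_dim K ((cont_space (pair_space L \<rho>))\<lparr>carrier :=
         mod_hom.ker (cont_space (pair_space L \<rho>)) (cont_space (pair_space L S)) (res S)
           \<inter> C_sub_L L \<rho>\<rparr>)
       +c
       vs_dim K ((cont_space (pair_space L S))\<lparr>carrier :=
         mod_hom.ker (cont_space (pair_space L S)) (cont_space (pair_space L (S \<inter> diagonal L))) (res (S \<inter> diagonal L))\<rparr>)" (is ?codim)
proof -
  let ?D = "S \<inter> diagonal L"
  let ?CL = "cont_space L :: ('k, 'a \<Rightarrow> 'k) module"
  let ?C\<rho> = "cont_space (pair_space L \<rho>) :: ('k, 'a \<times> 'a \<Rightarrow> 'k) module"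
  let ?CS = "cont_space (pair_space L S) :: ('k, 'a \<times> 'a \<Rightarrow> 'k) module"
  let ?CD = "cont_space (pair_space L ?D) :: ('k, 'a \<times> 'a \<Rightarrow> 'k) module"
  have \<rho>L: "\<rho> \<subseteq> topspace L \<times> topspace L"
    using closedin_subset[OF \<rho>(2)] by simp
  have S\<rho>: "S \<subseteq> \<rho>"
    using S(1) by blast
  interpret \<Delta>: linear_map K ?CL ?C\<rho> "Delta_rel L \<rho>"
    unfolding K_def by (rule linear_map_Delta_rel[OF \<rho>L])
  interpret r1: linear_map K ?C\<rho> ?CS "res S"
    unfolding K_def by (rule linear_map_res) (use \<rho>L S\<rho> in auto)
  interpret r2: linear_map K ?CS ?CD "res ?D"
    unfolding K_def by (rule linear_map_res) (use \<rho>L S\<rho> in auto)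
  have C_eq: "C_sub_L L \<rho> = \<Delta>.im" "C_sub_rel L \<rho> = \<Delta>.ker"
    by (simp_all add: C_sub_L_def C_sub_rel_def)
  \<comment> \<open>The first map of the sequence is the restriction of \<open>res S\<close> to the image of \<open>\<Delta>\<close>.\<close>
  interpret r: linear_map K "?C\<rho>\<lparr>carrier := \<Delta>.im\<rparr>" ?CS "res S"
    by (rule linear_map_restrict_domain[OF r1.linear_map_axioms \<Delta>.imT_is_subspace])
  have topS: "topspace (pair_space L S) = S" and topD: "topspace (pair_space L ?D) = ?D"
    using S\<rho> \<rho>L by auto
  have same: "y = z" if "y \<in> R" "z \<in> R" "(y, z) \<in> \<rho>" for y z
    using representatives_unique[OF \<rho>(1) R that] .
  have r_im: "r.im = res S ` Delta_rel L \<rho> ` carrier ?CL"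
    unfolding r.im_def by (simp add: \<Delta>.im_def)
  have im_ker: "r.im = r2.ker"
  proof
    show "r.im \<subseteq> r2.ker"
    proof
      fix h
      assume "h \<in> r.im"
      then obtain f where h: "h \<in> carrier ?CS" "h = res S (Delta_rel L \<rho> f)"
        using r.im_is_submodule unfolding r_im by (blast dest: LinearCombinations.submodule.subset)
      have "res ?D h = \<zero>\<^bsub>?CD\<^esub>"
        unfolding cont_space_simps(4) topD
        by (rule restrict_ext) (use S\<rho> in \<open>auto simp: h(2) Delta_rel_apply[OF \<rho>L]\<close>)
      with h(1) show "h \<in> r2.ker"
        by (simp add: r2.ker_def)
    qed
    show "r2.ker \<subseteq> r.im"
    proof
      fix g
      assume "g \<in> r2.ker"
      then have g: "g \<in> extensional S" "continuous_map (pair_space L S) euclidean g"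
        and "res ?D g = (\<lambda>p\<in>?D. 0)"
        unfolding r2.ker_def cont_space_simps topS topD by blast+
      then have "g (x, x) = 0" if "(x, x) \<in> S" for x
        using that S\<rho> \<rho>L by (auto simp: restrict_def fun_eq_iff Id_on_def split: if_splits)
      moreover have "y = z" if "(x, y) \<in> S" "(x, z) \<in> S" for x y z
      proof (rule same)
        show "y \<in> R" "z \<in> R"
          using that S(1) by auto
        have "(x, y) \<in> \<rho>" "(x, z) \<in> \<rho>"
          using that S\<rho> by auto
        then show "(y, z) \<in> \<rho>"
          using \<rho>(1) by (meson equivE symE transE)
      qed
      moreover have "x = y" if "(x, y) \<in> S" "(z, x) \<in> S" for x y z
        using that S(1) same[of x y] by blast
      ultimately obtain f where f: "continuous_map L euclidean f"
          "\<And>x y. (x, y) \<in> S \<Longrightarrow> f x - f y = g (x, y)"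
        using difference_extension[OF L S(2) _ _ g(2)] by metis
      let ?f = "restrict f (topspace L)"
      have "?f \<in> carrier ?CL"
        using f(1) by (simp add: cont_space_simps continuous_map_restrict_topspace)
      moreover have "g = res S (Delta_rel L \<rho> ?f)"
      proof (rule extensionalityI[OF g(1)])
        fix p
        assume "p \<in> S"
        moreover from this have "p \<in> \<rho>" "fst p \<in> topspace L" "snd p \<in> topspace L"
          using S\<rho> \<rho>L by auto
        ultimately show "g p = res S (Delta_rel L \<rho> ?f) p"
          using f(2)[of "fst p" "snd p"] by (simp add: Delta_rel_apply[OF \<rho>L])
      qed simp
      ultimately show "g \<in> r.im"
        unfolding r_im by blast
    qed
  qed
  show ?exact
    unfolding exact_at_middle_def C_eq
    using r.linear_map_axioms r2.linear_map_axioms im_ker by blast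
  have "r.ker = r1.ker \<inter> \<Delta>.im"
    using \<Delta>.imT_is_subspace
    by (auto simp: r.ker_def r1.ker_def dest: subspace.submod LinearCombinations.submodule.subset)
  then show ?codim
    using \<Delta>.vs_codim_ker r.vs_dim_rank_nullity unfolding C_eq im_ker
    by (auto intro: ordIso_transitive)
qed

theorem theorem3p10:
  fixes L :: "'a topology" and \<rho> S :: "('a \<times> 'a) set" and R :: "'a set"
  assumes "compact_space L" and "Hausdorff_space L"
    and "equiv (topspace L) \<rho>" and "closedin (prod_topology L L) \<rho>"
    and "representatives (topspace L) \<rho> R"
    and "S \<subseteq> (topspace L \<times> R) \<inter> \<rho>" and "closedin (prod_topology L L) S"
  shows
    "exact_at_middle real_scalars
       ((cont_space (pair_space L \<rho>))\<lparr>carrier := C_sub_L L \<rho>\<rparr>)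
       (cont_space (pair_space L S))
       (cont_space (pair_space L (S \<inter> diagonal L)))
       (res S) (res (S \<inter> diagonal L))
     \<and>
     vs_codim real_scalars (cont_space L) (C_sub_rel L \<rho>) =o
       vs_dim real_scalars ((cont_space (pair_space L \<rho>))\<lparr>carrier :=
         mod_hom.ker (cont_space (pair_space L \<rho>)) (cont_space (pair_space L S)) (res S)
           \<inter> C_sub_L L \<rho>\<rparr>)
       +c
       vs_dim real_scalars ((cont_space (pair_space L S))\<lparr>carrier :=
         mod_hom.ker (cont_space (pair_space L S)) (cont_space (pair_space L (S \<inter> diagonal L))) (res (S \<inter> diagonal L))\<rparr>)
     \<and>
     exact_at_middle complex_scalars
       ((cont_space (pair_space L \<rho>))\<lparr>carrier := C_sub_L L \<rho>\<rparr>)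
       (cont_space (pair_space L S))
       (cont_space (pair_space L (S \<inter> diagonal L)))
       (res S) (res (S \<inter> diagonal L))
     \<and>
     vs_codim complex_scalars (cont_space L) (C_sub_rel L \<rho>) =o
       vs_dim complex_scalars ((cont_space (pair_space L \<rho>))\<lparr>carrier :=
         mod_hom.ker (cont_space (pair_space L \<rho>)) (cont_space (pair_space L S)) (res S)
           \<inter> C_sub_L L \<rho>\<rparr>)
       +c
       vs_dim complex_scalars ((cont_space (pair_space L S))\<lparr>carrier :=
         mod_hom.ker (cont_space (pair_space L S)) (cont_space (pair_space L (S \<inter> diagonal L))) (res (S \<inter> diagonal L))\<rparr>)"
  using exact_and_codim_cont_space[OF assms, where 'k = real]
    exact_and_codim_cont_space[OF assms, where 'k = complex]
  by blast

end
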